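(* Let $p$ be a prime and $m$ an integer with $p>m\geq 2$, and for each integer $n\geq 1$ let $G_n:=SL_m(\mathbb{Z}/p^n\mathbb{Z})$. Then for every real number $d>4$, $$diam_{worst}(G_n)=O\left(\log^d(|G_n|)\right),$$ i.e. there is a constant $C$ (depending on $p$, $m$, $d$ but not on $n$) such that $diam_{worst}(G_n)\leq C\log^d(|G_n|)$ for all $n\geq 1$. Furthermore: (i) if $m>2$, the prime $p$ may also be equal to $m$, i.e. the same conclusion (for every real $d>4$) holds whenever $p$ is a prime with $p\geq m>2$; (ii) if $m=2$ (and $p>2$), the same conclusion holds for every real $d>3$.
   Context: For a finite group $G$ and a generating set $S\subseteq G$, $diam(G,S)$ denotes the minimal number $k$ such that every element of $G$ can be written as a product of at most $k$ elements of $S\cup S^{-1}$. Define $diam_{worst}(G):=\max\{diam(G,S): S\subseteq G,\ S \text{ generates } G\}$. Here $\log x$ denotes $\log_2 x$, and $\log^d(x)$ means $(\log x)^d$. *)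

theory Defs
  imports
    Complex_Main
    "HOL-Computational_Algebra.Primes"
    "HOL-Number_Theory.Cong"
    "HOL-Algebra.Generated_Groups"
    "Jordan_Normal_Form.Determinant"
begin

text \<open>
  The ring of integers modulo \<open>N\<close> is represented by the
  residues \<open>{0..<N}\<close>.  A matrix over it is therefore an integer matrix with entries in \<open>{0..<N}\<close>;
  since reduction is a ring homomorphism, the product over the residue ring is the reduction
  of the integer product, and its determinant is the residue of the integer determinant.
\<close>

abbreviation mat_mod :: "nat \<Rightarrow> int mat \<Rightarrow> int mat" where
  "mat_mod N \<equiv> map_mat (\<lambda>x. x mod int N)"

definition SL :: "nat \<Rightarrow> nat \<Rightarrow> int mat monoid" where
  "SL m N =
    \<lparr>carrier = {A \<in> carrier_mat m m.
        (\<forall>i<m. \<forall>j<m. A $$ (i, j) \<in> {0..<int N}) \<and> [det A = 1] (mod int N)},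
     mult = (\<lambda>A B. mat_mod N (A * B)),
     one = mat_mod N (1\<^sub>m m)\<rparr>"

definition diam :: "('a, 'b) monoid_scheme \<Rightarrow> 'a set \<Rightarrow> nat" where
  "diam G S = (LEAST k. \<forall>g \<in> carrier G. \<exists>ws.
     set ws \<subseteq> S \<union> set_inv\<^bsub>G\<^esub> S \<and> length ws \<le> k \<and> foldr (\<otimes>\<^bsub>G\<^esub>) ws \<one>\<^bsub>G\<^esub> = g)"

definition diam_worst :: "('a, 'b) monoid_scheme \<Rightarrow> nat" where
  "diam_worst G = Max {diam G S | S. S \<subseteq> carrier G \<and> generate G S = carrier G}"


text \<open>
  For a finite group \<open>G\<close> the \<open>LEAST\<close> in \<^const>\<open>diam\<close> and the \<open>Max\<close> in \<^const>\<open>diam_worst\<close>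
  are taken over nonempty (respectively finite nonempty) sets, and \<^const>\<open>SL\<close> is a finite group:
\<close>

lemma (in group) diam_LEAST_nonempty:
  assumes fin: "finite (carrier G)" and S: "S \<subseteq> carrier G" and gen: "generate G S = carrier G"
  shows "\<exists>k. \<forall>g \<in> carrier G. \<exists>ws.
     set ws \<subseteq> S \<union> set_inv\<^bsub>G\<^esub> S \<and> length ws \<le> k \<and> foldr (\<otimes>\<^bsub>G\<^esub>) ws \<one>\<^bsub>G\<^esub> = g"
proof -
  let ?T = "S \<union> set_inv\<^bsub>G\<^esub> S"
  have T: "?T \<subseteq> carrier G" using S by (auto simp: SET_INV_def)
  have clo: "foldr (\<otimes>) ws \<one> \<in> carrier G" if "set ws \<subseteq> ?T" for ws
    using that T by (induction ws) auto
  have app: "foldr (\<otimes>) (us @ vs) \<one> = foldr (\<otimes>) us \<one> \<otimes> foldr (\<otimes>) vs \<one>"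
    if "set us \<subseteq> ?T" "set vs \<subseteq> ?T" for us vs
    using that(1)
  proof (induction us)
    case Nil
    then show ?case using clo[OF that(2)] by simp
  next
    case (Cons u us)
    then have "u \<in> carrier G" and "foldr (\<otimes>) us \<one> \<in> carrier G" using T clo by auto
    then show ?case using Cons clo[OF that(2)] by (simp add: m_assoc)
  qed
  have "\<exists>ws. set ws \<subseteq> ?T \<and> foldr (\<otimes>) ws \<one> = g" if "g \<in> generate G S" for g
    using that
  proof (induction rule: generate.induct)
    case one
    show ?case by (rule exI[of _ "[]"]) simp
  next
    case (incl h)
    then show ?case using S by (intro exI[of _ "[h]"]) auto
  next
    case (inv h)
    then show ?case using S by (intro exI[of _ "[inv h]"]) (auto simp: SET_INV_def)
  next
    case (eng h1 h2)
    then obtain us vs where "set us \<subseteq> ?T" "foldr (\<otimes>) us \<one> = h1"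
      "set vs \<subseteq> ?T" "foldr (\<otimes>) vs \<one> = h2" by blast
    then show ?case using app by (intro exI[of _ "us @ vs"]) auto
  qed
  then obtain w where w: "set (w g) \<subseteq> ?T \<and> foldr (\<otimes>) (w g) \<one> = g" if "g \<in> carrier G" for g
    using gen by metis
  have "length (w g) \<le> Max ((\<lambda>g. length (w g)) ` carrier G)" if "g \<in> carrier G" for g
    using that fin by (intro Max_ge) auto
  then show ?thesis using w by blast
qed

lemma (in group) diam_worst_Max_nonempty:
  assumes fin: "finite (carrier G)"
  shows "finite {diam G S | S. S \<subseteq> carrier G \<and> generate G S = carrier G}"
    and "{diam G S | S. S \<subseteq> carrier G \<and> generate G S = carrier G} \<noteq> {}"
proof -
  have "{diam G S | S. S \<subseteq> carrier G \<and> generate G S = carrier G} \<subseteq> diam G ` Pow (carrier G)"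
    by auto
  then show "finite {diam G S | S. S \<subseteq> carrier G \<and> generate G S = carrier G}"
    using fin by (meson finite_Pow_iff finite_imageI finite_subset)
  have "generate G (carrier G) = carrier G"
    using generate_incl[of "carrier G"] generate.incl[of _ "carrier G" G] by blast
  then show "{diam G S | S. S \<subseteq> carrier G \<and> generate G S = carrier G} \<noteq> {}" by blast
qed

lemma mat_mod_mult:
  assumes A: "A \<in> carrier_mat m m" and B: "B \<in> carrier_mat m m"
  shows "mat_mod N (mat_mod N A * B) = mat_mod N (A * B)"
    and "mat_mod N (A * mat_mod N B) = mat_mod N (A * B)"
proof -
  have "(\<Sum>k = 0..<m. A $$ (i, k) mod int N * B $$ (k, j)) mod int N
      = (\<Sum>k = 0..<m. A $$ (i, k) * B $$ (k, j)) mod int N" for i j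
    by (subst (1 2) mod_sum_eq[symmetric]) (simp add: mod_simps)
  then show "mat_mod N (mat_mod N A * B) = mat_mod N (A * B)"
    using A B by (intro eq_matI) (auto simp: scalar_prod_def)
  have "(\<Sum>k = 0..<m. A $$ (i, k) * (B $$ (k, j) mod int N)) mod int N
      = (\<Sum>k = 0..<m. A $$ (i, k) * B $$ (k, j)) mod int N" for i j
    by (subst (1 2) mod_sum_eq[symmetric]) (simp add: mod_simps)
  then show "mat_mod N (A * mat_mod N B) = mat_mod N (A * B)"
    using A B by (intro eq_matI) (auto simp: scalar_prod_def)
qed

lemma det_mat_mod:
  assumes A: "A \<in> carrier_mat m m"
  shows "[det (mat_mod N A) = det A] (mod int N)"
proof -
  have M: "mat_mod N A \<in> carrier_mat m m" using A by simp
  have "(\<Prod>i = 0..<m. mat_mod N A $$ (i, q i)) = (\<Prod>i = 0..<m. A $$ (i, q i) mod int N)"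
    if "q permutes {0..<m}" for q
    using A permutes_in_image[OF that] by (intro prod.cong) auto
  then show ?thesis
    unfolding det_def'[OF A] det_def'[OF M]
    by (intro cong_sum cong_scalar_left) (auto simp: cong_def intro!: cong_prod[unfolded cong_def])
qed

lemma finite_SL: "finite (carrier (SL m N))"
proof -
  have "carrier (SL m N) \<subseteq> (\<lambda>f. mat m m f) ` (({0..<m} \<times> {0..<m}) \<rightarrow>\<^sub>E {0..<int N})"
  proof
    fix A assume "A \<in> carrier (SL m N)"
    then have A: "A \<in> carrier_mat m m" "\<forall>i<m. \<forall>j<m. A $$ (i, j) \<in> {0..<int N}"
      by (auto simp: SL_def)
    let ?f = "restrict (\<lambda>ij. A $$ ij) ({0..<m} \<times> {0..<m})"
    have "A = mat m m ?f" using A(1) by (intro eq_matI) auto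
    moreover have "?f \<in> ({0..<m} \<times> {0..<m}) \<rightarrow>\<^sub>E {0..<int N}" using A(2) by auto
    ultimately show "A \<in> (\<lambda>f. mat m m f) ` (({0..<m} \<times> {0..<m}) \<rightarrow>\<^sub>E {0..<int N})" by blast
  qed
  then show ?thesis by (rule finite_subset) (intro finite_imageI finite_PiE; simp)
qed

lemma group_SL:
  assumes N: "N > 0"
  shows "group (SL m N)"
proof -
  have red: "mat_mod N A \<in> carrier (SL m N)"
    if "A \<in> carrier_mat m m" "[det A = 1] (mod int N)" for A
    using that det_mat_mod[OF that(1), of N] N by (auto simp: SL_def intro: cong_trans)
  have id: "mat_mod N A = A" if "A \<in> carrier (SL m N)" for A
    using that by (intro eq_matI) (auto simp: SL_def)
  have C: "A \<in> carrier_mat m m" "[det A = 1] (mod int N)" if "A \<in> carrier (SL m N)" for A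
    using that by (auto simp: SL_def)
  have mult: "A \<otimes>\<^bsub>SL m N\<^esub> B = mat_mod N (A * B)" for A B by (simp add: SL_def)
  have one: "\<one>\<^bsub>SL m N\<^esub> = mat_mod N (1\<^sub>m m)" by (simp add: SL_def)
  show ?thesis
  proof (rule groupI)
    fix A B assume A: "A \<in> carrier (SL m N)" and B: "B \<in> carrier (SL m N)"
    have "[det (A * B) = 1] (mod int N)"
      unfolding det_mult[OF C(1)[OF A] C(1)[OF B]]
      using cong_mult[OF C(2)[OF A] C(2)[OF B]] by simp
    then show "A \<otimes>\<^bsub>SL m N\<^esub> B \<in> carrier (SL m N)"
      unfolding mult using C(1)[OF A] C(1)[OF B] by (intro red) auto
  next
    show "\<one>\<^bsub>SL m N\<^esub> \<in> carrier (SL m N)" unfolding one by (rule red) auto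
  next
    fix A B D
    assume A: "A \<in> carrier (SL m N)" and B: "B \<in> carrier (SL m N)" and D: "D \<in> carrier (SL m N)"
    note c = C(1)[OF A] C(1)[OF B] C(1)[OF D]
    have "mat_mod N (mat_mod N (A * B) * D) = mat_mod N (A * B * D)"
      using c by (intro mat_mod_mult(1)[where m = m]) auto
    also have "A * B * D = A * (B * D)" using c by (intro assoc_mult_mat) auto
    also have "mat_mod N \<dots> = mat_mod N (A * mat_mod N (B * D))"
      using c by (intro mat_mod_mult(2)[where m = m, symmetric]) auto
    finally show "A \<otimes>\<^bsub>SL m N\<^esub> B \<otimes>\<^bsub>SL m N\<^esub> D = A \<otimes>\<^bsub>SL m N\<^esub> (B \<otimes>\<^bsub>SL m N\<^esub> D)"
      unfolding mult .
  next
    fix A assume A: "A \<in> carrier (SL m N)"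
    show "\<one>\<^bsub>SL m N\<^esub> \<otimes>\<^bsub>SL m N\<^esub> A = A"
      unfolding mult one using mat_mod_mult(1)[of "1\<^sub>m m" m A N] C(1)[OF A] id[OF A] by simp
  next
    fix A assume A: "A \<in> carrier (SL m N)"
    note a = C(1)[OF A] and ad = adj_mat[OF C(1)[OF A]]
    have "det A * det (adj_mat A) = det A ^ m"
      using det_mult[OF a ad(1)] ad(2) by simp
    then have "[det (adj_mat A) = 1] (mod int N)"
      using cong_pow[OF C(2)[OF A], of m] cong_scalar_right[OF C(2)[OF A], of "det (adj_mat A)"]
      by (metis cong_sym cong_trans mult_1 power_one)
    then have B: "mat_mod N (adj_mat A) \<in> carrier (SL m N)" using ad(1) by (rule red[rotated])
    have "mat_mod N (mat_mod N (adj_mat A) * A) = mat_mod N (det A \<cdot>\<^sub>m 1\<^sub>m m)"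
      using mat_mod_mult(1)[OF ad(1) a, of N] ad(3) by simp
    also have "\<dots> = mat_mod N (1\<^sub>m m)"
      using C(2)[OF A] by (intro eq_matI) (auto simp: cong_def)
    finally show "\<exists>B\<in>carrier (SL m N). B \<otimes>\<^bsub>SL m N\<^esub> A = \<one>\<^bsub>SL m N\<^esub>"
      unfolding mult one using B by blast
  qed
qed

end

theory Submission
  imports Defs
begin

text \<open>
  Solovay--Kitaev descent along the congruence filtration.  An element congruent to \<open>1 + p ^ k X\<close>
  modulo \<open>p ^ (k + 1)\<close> has leading term \<open>X\<close>, a traceless matrix modulo \<open>p\<close>.  Products add leading
  terms of the same level, and commutators of elements of levels \<open>a\<close> and \<open>b\<close> have level \<open>a + b\<close> and the
  Lie bracket of the leading terms.  For \<open>2 < p\<close> and \<open>m \<le> p\<close> every traceless matrix modulo \<open>p\<close> is a sum of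
  \<open>c = 2\<close> brackets of traceless matrices, and \<open>c = 1\<close> suffices for \<open>m = 2\<close>.  Hence passing from level \<open>k\<close>
  to level \<open>2k\<close> multiplies word lengths by \<open>4c = 2 ^ e\<close>, all leading terms of level \<open>k\<close> are reached by words
  of length \<open>O(k ^ e)\<close>, and correcting an element level by level gives diameter \<open>O(n ^ (e + 1))\<close>, while
  \<open>n \<le> log 2 |G_n|\<close>.  At level 1 the length is bounded by the number of residue matrices modulo \<open>p ^ 2\<close>,
  independently of \<open>n\<close>.
\<close>

section \<open>Congruences of integer matrices\<close>

lemma square_mat_closed [simp]:
  fixes A B :: "int mat"
  assumes "A \<in> carrier_mat m m" "B \<in> carrier_mat m m"
  shows "A * B \<in> carrier_mat m m" "A - B \<in> carrier_mat m m"
  using assms by (auto intro: minus_carrier_mat)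

text \<open>Comparing reductions makes this an equivalence relation without dimension hypotheses;
  only the entrywise form requires them.\<close>

definition mat_cong :: "nat \<Rightarrow> int mat \<Rightarrow> int mat \<Rightarrow> bool" where
  "mat_cong N A B \<longleftrightarrow> mat_mod N A = mat_mod N B"

lemma mat_cong_refl [simp]: "mat_cong N A A"
  and mat_cong_sym: "mat_cong N A B \<Longrightarrow> mat_cong N B A"
  and mat_cong_trans [trans]: "mat_cong N A B \<Longrightarrow> mat_cong N B C \<Longrightarrow> mat_cong N A C"
  by (simp_all add: mat_cong_def)

lemma mat_cong_iff:
  assumes "A \<in> carrier_mat m m" "B \<in> carrier_mat m m"
  shows "mat_cong N A B \<longleftrightarrow> (\<forall>i<m. \<forall>j<m. [A $$ (i, j) = B $$ (i, j)] (mod int N))"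
proof
  assume "mat_cong N A B"
  then have "mat_mod N A $$ (i, j) = mat_mod N B $$ (i, j)" for i j
    by (simp add: mat_cong_def)
  moreover have "mat_mod N A $$ (i, j) = A $$ (i, j) mod int N" "mat_mod N B $$ (i, j) = B $$ (i, j) mod int N"
    if "i < m" "j < m" for i j
    using assms that by auto
  ultimately show "\<forall>i<m. \<forall>j<m. [A $$ (i, j) = B $$ (i, j)] (mod int N)"
    unfolding cong_def by metis
next
  assume "\<forall>i<m. \<forall>j<m. [A $$ (i, j) = B $$ (i, j)] (mod int N)"
  then show "mat_cong N A B"
    unfolding mat_cong_def using assms by (intro eq_matI) (auto simp: cong_def)
qed

lemma mat_cong_dvd:
  assumes "mat_cong N A B" "M dvd N" "A \<in> carrier_mat m m" "B \<in> carrier_mat m m"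
  shows "mat_cong M A B"
  using assms by (auto simp: mat_cong_iff[of _ m] intro: cong_dvd_modulus[OF _ of_nat_dvd_iff[THEN iffD2]])

lemma mat_cong_mat_mod:
  assumes "M dvd N" "A \<in> carrier_mat m m"
  shows "mat_cong M (mat_mod N A) A"
  using assms by (simp add: mat_cong_iff[of _ m] cong_def mod_mod_cancel)

lemma mat_cong_mult:
  assumes "mat_cong N A A'" "mat_cong N B B'"
    and [simp]: "A \<in> carrier_mat m m" "A' \<in> carrier_mat m m" "B \<in> carrier_mat m m" "B' \<in> carrier_mat m m"
  shows "mat_cong N (A * B) (A' * B')"
proof -
  have "mat_mod N (A * B) = mat_mod N (A * mat_mod N B)"
    using mat_mod_mult(2)[of A m B N] by simp
  also have "\<dots> = mat_mod N (A * B')"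
    using mat_mod_mult(2)[of A m B' N] assms(2) by (simp add: mat_cong_def)
  also have "\<dots> = mat_mod N (mat_mod N A * B')"
    using mat_mod_mult(1)[of A m B' N] by simp
  also have "\<dots> = mat_mod N (A' * B')"
    using mat_mod_mult(1)[of A' m B' N] assms(1) by (simp add: mat_cong_def)
  finally show ?thesis by (simp add: mat_cong_def)
qed

lemma mat_cong_add:
  assumes "mat_cong N A A'" "mat_cong N B B'"
    and "A \<in> carrier_mat m m" "A' \<in> carrier_mat m m" "B \<in> carrier_mat m m" "B' \<in> carrier_mat m m"
  shows "mat_cong N (A + B) (A' + B')"
  using assms by (auto simp: mat_cong_iff[of _ m] intro!: cong_add)

lemma mat_cong_minus:
  assumes "mat_cong N A A'" "mat_cong N B B'"
    and "A \<in> carrier_mat m m" "A' \<in> carrier_mat m m" "B \<in> carrier_mat m m" "B' \<in> carrier_mat m m"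
  shows "mat_cong N (A - B) (A' - B')"
  using assms by (auto simp: mat_cong_iff[of _ m] intro!: cong_diff simp del: minus_carrier_mat)

text \<open>The scalar \<open>M\<close> raises the modulus by the same factor. This is why a leading
  term at level \<open>k\<close> matters only modulo \<open>p\<close>.\<close>

lemma mat_cong_smult:
  assumes "mat_cong N A A'" "A \<in> carrier_mat m m" "A' \<in> carrier_mat m m"
  shows "mat_cong (M * N) (int M \<cdot>\<^sub>m A) (int M \<cdot>\<^sub>m A')"
  using assms by (auto simp: mat_cong_iff[of _ m] cong_iff_dvd_diff simp flip: right_diff_distrib)

section \<open>Leading terms along the congruence filtration\<close>

definition lead :: "nat \<Rightarrow> nat \<Rightarrow> nat \<Rightarrow> int mat \<Rightarrow> int mat" where
  "lead m p k X = 1\<^sub>m m + int (p ^ k) \<cdot>\<^sub>m X"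

lemma lead_carrier [simp]: "X \<in> carrier_mat m m \<Longrightarrow> lead m p k X \<in> carrier_mat m m"
  by (simp add: lead_def)

lemma mat_cong_lead:
  assumes "mat_cong p X Y" "X \<in> carrier_mat m m" "Y \<in> carrier_mat m m"
  shows "mat_cong (p ^ (k + 1)) (lead m p k X) (lead m p k Y)"
  using mat_cong_add[OF mat_cong_refl mat_cong_smult[OF assms, of "p ^ k"], of _ m] assms
  by (simp add: lead_def mult.commute)

lemma mat_cong_one_lead:
  assumes "U \<in> carrier_mat m m" "mat_cong (p ^ k) U (1\<^sub>m m)"
  obtains X where "X \<in> carrier_mat m m" "U = lead m p k X"
proof
  let ?X = "mat m m (\<lambda>(i, j). (U $$ (i, j) - 1\<^sub>m m $$ (i, j)) div int (p ^ k))"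
  show "?X \<in> carrier_mat m m" by simp
  have "int (p ^ k) dvd U $$ (i, j) - 1\<^sub>m m $$ (i, j)" if "i < m" "j < m" for i j
    using assms that unfolding mat_cong_iff[OF assms(1) one_carrier_mat] cong_iff_dvd_diff by blast
  then have "U $$ (i, j) = 1\<^sub>m m $$ (i, j) + int (p ^ k) * ((U $$ (i, j) - 1\<^sub>m m $$ (i, j)) div int (p ^ k))"
    if "i < m" "j < m" for i j
    using that by (metis add.commute diff_add_cancel dvd_mult_div_cancel)
  then show "U = lead m p k ?X"
    using assms(1) by (intro eq_matI) (auto simp: lead_def)
qed

lemma mat_cong_lead_one:
  assumes "X \<in> carrier_mat m m"
  shows "mat_cong (p ^ k) (lead m p k X) (1\<^sub>m m)"
  using assms by (auto simp: mat_cong_iff[of _ m] lead_def cong_iff_dvd_diff)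

text \<open>Trades a congruence for an exact equation by changing the leading term within its class
  modulo \<open>p\<close>, so that the exact product formulas below apply.\<close>

lemma mat_cong_lead_leadE:
  assumes U: "U \<in> carrier_mat m m" and X: "X \<in> carrier_mat m m" and p: "p > 0"
    and c: "mat_cong (p ^ (k + 1)) U (lead m p k X)"
  obtains Y where "Y \<in> carrier_mat m m" "U = lead m p k Y" "mat_cong p Y X"
proof -
  have "mat_cong (p ^ k) U (1\<^sub>m m)"
    using mat_cong_trans[OF mat_cong_dvd[OF c, of "p ^ k"] mat_cong_lead_one[OF X]] U X
    by (simp add: le_imp_power_dvd)
  then obtain Y where Y: "Y \<in> carrier_mat m m" "U = lead m p k Y"
    using mat_cong_one_lead[OF U] by blast
  have "[Y $$ (i, j) = X $$ (i, j)] (mod int p)" if "i < m" "j < m" for i j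
  proof -
    have "[lead m p k Y $$ (i, j) = lead m p k X $$ (i, j)] (mod int (p ^ (k + 1)))"
      using c that Y X by (simp add: mat_cong_iff[of _ m])
    then have "int p ^ k * int p dvd int p ^ k * (Y $$ (i, j) - X $$ (i, j))"
      using that X Y by (simp add: lead_def cong_iff_dvd_diff algebra_simps)
    then show ?thesis using p by (simp add: cong_iff_dvd_diff)
  qed
  then show ?thesis using that Y X by (simp add: mat_cong_iff[of _ m])
qed

text \<open>Kept as an exact identity with independent levels: both the additivity of leading terms
  and the commutator formula are read off from it.\<close>

lemma lead_mult:
  assumes [simp]: "X \<in> carrier_mat m m" "Y \<in> carrier_mat m m"
  shows "lead m p a X * lead m p b Y
    = 1\<^sub>m m + int (p ^ a) \<cdot>\<^sub>m X + int (p ^ b) \<cdot>\<^sub>m Y + int (p ^ (a + b)) \<cdot>\<^sub>m (X * Y)"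
proof -
  have "lead m p a X * lead m p b Y
    = 1\<^sub>m m * lead m p b Y + (int (p ^ a) \<cdot>\<^sub>m X) * lead m p b Y"
    by (subst lead_def) (rule add_mult_distrib_mat[of _ m m _ _ m], auto)
  also have "(int (p ^ a) \<cdot>\<^sub>m X) * lead m p b Y = int (p ^ a) \<cdot>\<^sub>m (X * lead m p b Y)"
    by (rule mult_smult_assoc_mat[of _ m m _ m]) auto
  also have "X * lead m p b Y = X * 1\<^sub>m m + X * (int (p ^ b) \<cdot>\<^sub>m Y)"
    unfolding lead_def by (rule mult_add_distrib_mat[of _ m m _ m]) auto
  also have "X * (int (p ^ b) \<cdot>\<^sub>m Y) = int (p ^ b) \<cdot>\<^sub>m (X * Y)"
    by (rule mult_smult_distrib[of _ m m _ m]) auto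
  finally have e: "lead m p a X * lead m p b Y
    = 1\<^sub>m m * lead m p b Y + int (p ^ a) \<cdot>\<^sub>m (X * 1\<^sub>m m + int (p ^ b) \<cdot>\<^sub>m (X * Y))" .
  show ?thesis
    unfolding e left_mult_one_mat[OF lead_carrier[OF assms(2)]] right_mult_one_mat[OF assms(1)]
    by (intro eq_matI) (auto simp: lead_def ac_simps distrib_left power_add
        carrier_matD[OF assms(1)] carrier_matD[OF assms(2)] simp del: index_mult_mat(1))
qed

text \<open>The cross term has level \<open>k + k\<close>, which is at least \<open>k + 1\<close>
  because \<open>k \<ge> 1\<close>.\<close>

lemma lead_mult_cong:
  assumes [simp]: "X \<in> carrier_mat m m" "Y \<in> carrier_mat m m" and k: "k \<ge> 1"
  shows "mat_cong (p ^ (k + 1)) (lead m p k X * lead m p k Y) (lead m p k (X + Y))"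
proof -
  have "lead m p k X * lead m p k Y = lead m p k (X + Y) + int (p ^ (k + k)) \<cdot>\<^sub>m (X * Y)"
    unfolding lead_mult[OF assms(1,2)]
    by (intro eq_matI) (auto simp: lead_def distrib_left carrier_matD[OF assms(1)]
        carrier_matD[OF assms(2)] simp del: index_mult_mat(1))
  moreover have "int (p ^ (k + 1)) dvd int (p ^ (k + k))"
    using k by (intro of_nat_dvd_iff[THEN iffD2] le_imp_power_dvd) simp
  ultimately show ?thesis
    by (auto simp: mat_cong_iff[of _ m] cong_iff_dvd_diff carrier_matD[OF assms(1)]
        carrier_matD[OF assms(2)] simp del: index_mult_mat(1) of_nat_power)
qed

abbreviation bracket :: "int mat \<Rightarrow> int mat \<Rightarrow> int mat" where
  "bracket X Y \<equiv> X * Y - Y * X"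

text \<open>In \<open>lead_mult\<close> only the last term depends on the order of the
  factors.\<close>

lemma lead_commutator:
  assumes X: "X \<in> carrier_mat m m" and Y: "Y \<in> carrier_mat m m"
  shows "lead m p a X * lead m p b Y
    = lead m p b Y * lead m p a X + int (p ^ (a + b)) \<cdot>\<^sub>m bracket X Y"
  unfolding lead_mult[OF X Y] lead_mult[OF Y X] using X Y
  by (intro eq_matI) (auto simp: ac_simps right_diff_distrib simp del: index_mult_mat(1))

text \<open>Start from \<open>U V = V U + p ^ (a + b) Z\<close>, where \<open>Z\<close> is the
  bracket modulo \<open>p\<close>. As \<open>U\<close> and \<open>V\<close> are \<open>1\<close>
  modulo \<open>p\<close>, the last term may be multiplied by \<open>V U\<close> on the right, so
  \<open>U V\<close> becomes \<open>(1 + p ^ (a + b) Z) V U\<close>, and \<open>U' V'\<close>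
  cancels \<open>V U\<close>. Inverses are needed only modulo \<open>p ^ (a + b + 1)\<close>, so the
  argument stays within integer matrices.\<close>

lemma mat_cong_commutator:
  assumes car: "U \<in> carrier_mat m m" "V \<in> carrier_mat m m" "U' \<in> carrier_mat m m" "V' \<in> carrier_mat m m"
      "X \<in> carrier_mat m m" "Y \<in> carrier_mat m m"
    and U: "mat_cong (p ^ (a + 1)) U (lead m p a X)" and V: "mat_cong (p ^ (b + 1)) V (lead m p b Y)"
    and inv: "mat_cong (p ^ (a + b + 1)) (U * U') (1\<^sub>m m)" "mat_cong (p ^ (a + b + 1)) (V * V') (1\<^sub>m m)"
    and p: "p > 0" and a: "a \<ge> 1" and b: "b \<ge> 1"
  shows "mat_cong (p ^ (a + b + 1)) (U * V * (U' * V')) (lead m p (a + b) (bracket X Y))"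
proof -
  note [simp] = car
  let ?N = "p ^ (a + b + 1)"
  let ?D = "int (p ^ (a + b)) \<cdot>\<^sub>m bracket X Y"
  obtain X1 where X1 [simp]: "X1 \<in> carrier_mat m m" and UX: "U = lead m p a X1" and X1X: "mat_cong p X1 X"
    using mat_cong_lead_leadE[OF _ _ p U] by auto
  obtain Y1 where Y1 [simp]: "Y1 \<in> carrier_mat m m" and VY: "V = lead m p b Y1" and Y1Y: "mat_cong p Y1 Y"
    using mat_cong_lead_leadE[OF _ _ p V] by auto
  have "mat_cong p (bracket X1 Y1) (bracket X Y)"
    by (intro mat_cong_minus[of _ _ _ _ _ m] mat_cong_mult[of _ _ _ _ _ m] X1X Y1Y) auto
  then have "mat_cong ?N (int (p ^ (a + b)) \<cdot>\<^sub>m bracket X1 Y1) ?D"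
    using mat_cong_smult[of p "bracket X1 Y1" "bracket X Y" m "p ^ (a + b)"] by (simp add: mult.commute)
  then have D1: "mat_cong ?N (U * V) (V * U + ?D)"
    unfolding UX VY lead_commutator[OF X1 Y1] by (intro mat_cong_add[of _ _ _ _ _ m]) auto
  have "mat_cong p U (1\<^sub>m m)" "mat_cong p V (1\<^sub>m m)"
    using mat_cong_dvd[OF mat_cong_lead_one[OF X1], where m = m, of p p a]
      mat_cong_dvd[OF mat_cong_lead_one[OF Y1], where m = m, of p p b] a b
    by (auto simp: UX VY dvd_power)
  then have "mat_cong p (bracket X Y * (V * U)) (bracket X Y * (1\<^sub>m m * 1\<^sub>m m))"
    by (intro mat_cong_mult[of _ _ _ _ _ m]) auto
  then have "mat_cong ?N (int (p ^ (a + b)) \<cdot>\<^sub>m (bracket X Y * (V * U))) ?D"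
    using mat_cong_smult[of p "bracket X Y * (V * U)" "bracket X Y" m "p ^ (a + b)"]
    by (simp add: mult.commute right_mult_one_mat[of _ m m])
  then have "mat_cong ?N (V * U + int (p ^ (a + b)) \<cdot>\<^sub>m (bracket X Y * (V * U))) (V * U + ?D)"
    by (intro mat_cong_add[of _ _ _ _ _ m]) auto
  also have "V * U + int (p ^ (a + b)) \<cdot>\<^sub>m (bracket X Y * (V * U)) = lead m p (a + b) (bracket X Y) * (V * U)"
    unfolding lead_def
    by (subst add_mult_distrib_mat[of _ m m _ _ m])
      (auto simp: mult_smult_assoc_mat[of _ m m _ m] left_mult_one_mat[of _ m m])
  finally have D2: "mat_cong ?N (lead m p (a + b) (bracket X Y) * (V * U)) (V * U + ?D)" .
  have VU: "mat_cong ?N (V * U * (U' * V')) (1\<^sub>m m)"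
  proof -
    have "V * U * (U' * V') = V * (U * U' * V')"
      by (simp add: assoc_mult_mat[of _ m m _ m _ m])
    also have "mat_cong ?N \<dots> (V * (1\<^sub>m m * V'))"
      by (intro mat_cong_mult[of _ _ _ _ _ m] inv) auto
    also have "\<dots> = V * V'" by (simp add: left_mult_one_mat[of _ m m])
    also note inv(2)
    finally show ?thesis .
  qed
  have L [simp]: "lead m p (a + b) (bracket X Y) \<in> carrier_mat m m"
    by simp
  have "mat_cong ?N (U * V * (U' * V')) (lead m p (a + b) (bracket X Y) * (V * U) * (U' * V'))"
    by (intro mat_cong_mult[of _ _ _ _ _ m] mat_cong_trans[OF D1 mat_cong_sym[OF D2]]) auto
  also have "lead m p (a + b) (bracket X Y) * (V * U) * (U' * V')
    = lead m p (a + b) (bracket X Y) * (V * U * (U' * V'))"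
    by (rule assoc_mult_mat[of _ m m _ m _ m]) auto
  also have "mat_cong ?N \<dots> (lead m p (a + b) (bracket X Y) * 1\<^sub>m m)"
    by (intro mat_cong_mult[of _ _ _ _ _ m] VU) auto
  finally show ?thesis by (simp add: right_mult_one_mat[of _ m m])
qed

section \<open>The trace as first-order term of the determinant\<close>

definition trc :: "int mat \<Rightarrow> int" where
  "trc A = (\<Sum>i<dim_row A. A $$ (i, i))"

text \<open>Mixed products carry at least two factors \<open>q\<close>. This evaluates the term of
  the identity permutation in \<open>det_lead\<close>.\<close>

lemma prod_one_plus_cong:
  fixes q :: int
  assumes "finite I"
  shows "[(\<Prod>i\<in>I. 1 + q * x i) = 1 + q * (\<Sum>i\<in>I. x i)] (mod q\<^sup>2)"
  using assms
proof (induction rule: finite_induct)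
  case (insert i I)
  have "[(1 + q * x i) * (\<Prod>i\<in>I. 1 + q * x i) = (1 + q * x i) * (1 + q * (\<Sum>i\<in>I. x i))] (mod q\<^sup>2)"
    by (rule cong_scalar_left[OF insert.IH])
  also have "[(1 + q * x i) * (1 + q * (\<Sum>i\<in>I. x i)) = 1 + q * (x i + (\<Sum>i\<in>I. x i))] (mod q\<^sup>2)"
    by (auto simp: cong_iff_dvd_diff algebra_simps power2_eq_square)
  finally show ?case using insert.hyps by simp
qed simp

text \<open>A permutation other than the identity moves two indices, so its term is divisible by the
  square of \<open>p ^ k\<close>.\<close>
lemma det_lead:
  assumes X: "X \<in> carrier_mat m m"
  shows "[det (lead m p k X) = 1 + int (p ^ k) * trc X] (mod (int (p ^ k))\<^sup>2)"
proof -
  let ?q = "int (p ^ k)" and ?A = "lead m p k X"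
  let ?f = "\<lambda>\<sigma>. signof \<sigma> * (\<Prod>i = 0..<m. ?A $$ (i, \<sigma> i))"
  have A: "?A \<in> carrier_mat m m" using X by simp
  have off: "?q\<^sup>2 dvd ?f \<sigma>" if s: "\<sigma> permutes {0..<m}" and "\<sigma> \<noteq> id" for \<sigma>
  proof -
    obtain i where i: "\<sigma> i \<noteq> i" using \<open>\<sigma> \<noteq> id\<close> by (auto simp: fun_eq_iff)
    define j where "j = \<sigma> i"
    have im: "i < m" using i s by (metis atLeastLessThan_iff permutes_not_in zero_le)
    have jm: "j < m" using permutes_in_image[OF s, of i] im by (simp add: j_def)
    \<comment> \<open>By injectivity \<open>j\<close> is moved as well, which supplies the second
      off-diagonal factor.\<close>
    have sj: "\<sigma> j \<noteq> j" using i permutes_inj[OF s] by (metis injD j_def)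
    have ij: "i \<noteq> j" using i by (simp add: j_def)
    have d: "?q dvd ?A $$ (l, \<sigma> l)" if "l < m" "\<sigma> l \<noteq> l" for l
      using that permutes_in_image[OF s, of l] X by (auto simp: lead_def)
    have "(\<Prod>l = 0..<m. ?A $$ (l, \<sigma> l))
      = ?A $$ (i, \<sigma> i) * (?A $$ (j, \<sigma> j) * (\<Prod>l\<in>{0..<m} - {i} - {j}. ?A $$ (l, \<sigma> l)))"
      using im jm ij by (subst prod.remove[of _ i], simp, simp, subst prod.remove[of _ j]) auto
    also have "?q\<^sup>2 dvd \<dots>"
      unfolding power2_eq_square mult.assoc[symmetric]
      using d[OF im i] d[OF jm sj] by (intro dvd_mult2 mult_dvd_mono) auto
    finally show ?thesis by simp
  qed
  have det: "det ?A = ?f id + (\<Sum>\<sigma>\<in>{\<sigma>. \<sigma> permutes {0..<m}} - {id}. ?f \<sigma>)"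
    unfolding det_def'[OF A] by (rule sum.remove) (auto simp: finite_permutations permutes_id)
  have "?q\<^sup>2 dvd (\<Sum>\<sigma>\<in>{\<sigma>. \<sigma> permutes {0..<m}} - {id}. ?f \<sigma>)"
    using off by (intro dvd_sum) auto
  then have "[det ?A = ?f id] (mod ?q\<^sup>2)"
    unfolding det cong_iff_dvd_diff by (simp only: add_diff_cancel_left')
  moreover have "?f id = (\<Prod>i\<in>{0..<m}. ?A $$ (i, i))"
    unfolding sign_id id_apply of_int_1 mult_1 ..
  moreover have "(\<Prod>i\<in>{0..<m}. ?A $$ (i, i)) = (\<Prod>i\<in>{0..<m}. 1 + ?q * X $$ (i, i))"
    using X by (intro prod.cong refl) (simp add: lead_def)
  moreover have "trc X = (\<Sum>i\<in>{0..<m}. X $$ (i, i))"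
    using X by (simp add: trc_def lessThan_atLeast0)
  ultimately show ?thesis
    using prod_one_plus_cong[of "{0..<m}" ?q "\<lambda>i. X $$ (i, i)"] by (metis cong_trans finite_atLeastLessThan)
qed

section \<open>Traceless matrices as sums of brackets\<close>

lemma index_bracket:
  fixes A B :: "int mat"
  assumes "A \<in> carrier_mat m m" "B \<in> carrier_mat m m" "i < m" "j < m"
  shows "bracket A B $$ (i, j)
    = (\<Sum>k = 0..<m. A $$ (i, k) * B $$ (k, j)) - (\<Sum>k = 0..<m. B $$ (i, k) * A $$ (k, j))"
  using assms by (simp add: scalar_prod_def)

text \<open>Bracketing with a diagonal matrix scales each entry, so an off-diagonal entry can be
  prescribed wherever \<open>d i - d j\<close> is invertible, while the diagonal of the result
  vanishes.\<close>

lemma bracket_diagonal: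
  fixes d :: "nat \<Rightarrow> int"
  assumes "B \<in> carrier_mat m m" "i < m" "j < m"
  shows "bracket (mat m m (\<lambda>(i, j). if i = j then d i else 0)) B $$ (i, j) = (d i - d j) * B $$ (i, j)"
proof -
  let ?A = "mat m m (\<lambda>(i, j). if i = j then d i else 0)"
  have "(\<Sum>k = 0..<m. ?A $$ (i, k) * B $$ (k, j)) = (\<Sum>k = 0..<m. if k = i then d i * B $$ (i, j) else 0)"
    using assms by (intro sum.cong) auto
  moreover have "(\<Sum>k = 0..<m. B $$ (i, k) * ?A $$ (k, j)) = (\<Sum>k = 0..<m. if k = j then d j * B $$ (i, j) else 0)"
    using assms by (intro sum.cong) auto
  ultimately show ?thesis
    using assms by (simp only: index_bracket[OF mat_carrier assms] sum.delta finite_atLeastLessThan)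
      (simp add: left_diff_distrib)
qed

text \<open>A superdiagonal of ones against a weighted subdiagonal gives a diagonal matrix of
  consecutive differences of the weights. Partial sums as weights thus produce a prescribed diagonal
  of trace zero.\<close>

lemma bracket_off_diagonals:
  fixes s :: "nat \<Rightarrow> int"
  assumes ij: "i < m" "j < m"
  shows "bracket (mat m m (\<lambda>(i, j). if j = Suc i then 1 else 0)) (mat m m (\<lambda>(i, j). if i = Suc j then s j else 0)) $$ (i, j)
    = (if i = j then (if Suc i < m then s i else 0) - (if i = 0 then 0 else s (i - 1)) else 0)"
proof -
  let ?C = "mat m m (\<lambda>(i, j). if j = Suc i then 1 else 0) :: int mat"
  let ?D = "mat m m (\<lambda>(i, j). if i = Suc j then s j else 0)"
  have "(\<Sum>k = 0..<m. ?C $$ (i, k) * ?D $$ (k, j)) = (\<Sum>k = 0..<m. if k = Suc i then (if i = j then s i else 0) else 0)"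
    using ij by (intro sum.cong) auto
  also have "\<dots> = (if i = j then (if Suc i < m then s i else 0) else 0)"
    by simp
  finally have 1: "(\<Sum>k = 0..<m. ?C $$ (i, k) * ?D $$ (k, j)) = \<dots>" .
  \<comment> \<open>The guard \<open>i \<noteq> 0\<close> on the right is essential, since
    \<open>i - 1\<close> is \<open>0\<close> for \<open>i = 0\<close>.\<close>
  have "(\<Sum>k = 0..<m. ?D $$ (i, k) * ?C $$ (k, j))
    = (\<Sum>k = 0..<m. if k = i - 1 then (if i = j \<and> i \<noteq> 0 then s (i - 1) else 0) else 0)"
    using ij by (intro sum.cong) auto
  also have "\<dots> = (if i = j then (if i = 0 then 0 else s (i - 1)) else 0)"
    using ij by auto
  finally have 2: "(\<Sum>k = 0..<m. ?D $$ (i, k) * ?C $$ (k, j)) = \<dots>" .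
  show ?thesis
    unfolding index_bracket[OF mat_carrier mat_carrier ij] 1 2 by simp
qed

text \<open>For prime \<open>p\<close> these are integer lifts of the Lie algebra of trace zero
  matrices over the field with \<open>p\<close> elements, hence the trace condition modulo
  \<open>p\<close> only.\<close>

definition traceless :: "nat \<Rightarrow> nat \<Rightarrow> int mat \<Rightarrow> bool" where
  "traceless m p X \<longleftrightarrow> X \<in> carrier_mat m m \<and> int p dvd trc X"

lemma traceless_carrier: "traceless m p X \<Longrightarrow> X \<in> carrier_mat m m"
  by (simp add: traceless_def)

lemma prime_inverse_mod:
  fixes x :: int
  assumes "prime p" "\<not> int p dvd x"
  obtains y where "[x * y = 1] (mod int p)"
proof -
  have "coprime x (int p)"
    using assms by (metis coprime_commute prime_imp_coprime prime_int_nat_transfer nat_int of_nat_0_le_iff prime_nat_int_transfer)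
  then show ?thesis using that cong_solve_coprime_int by blast
qed

text \<open>The diagonal matrix with entries \<open>2i - (m - 1)\<close> has trace zero and distinct entries modulo \<open>p\<close>,
  so its brackets yield every off-diagonal part.\<close>
lemma traceless_two_brackets:
  assumes p: "prime p" "p > 2" and mp: "m \<le> p" and X: "traceless m p X"
  obtains A B C D where "traceless m p A" "traceless m p B" "traceless m p C" "traceless m p D"
    "mat_cong p X (bracket A B + bracket C D)"
proof -
  define d :: "nat \<Rightarrow> int" where "d i = 2 * int i - (int m - 1)" for i
  have "\<exists>y. i \<noteq> j \<longrightarrow> [(d i - d j) * y = 1] (mod int p)" if "i < m" "j < m" for i j
  proof (cases "i = j")
    case False
    have "odd p" using p prime_odd_nat by blast
    then have "\<not> int p dvd 2" using p(2) zdvd_not_zless[of 2 "int p"] by simp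
    \<comment> \<open>Here \<open>m \<le> p\<close> enters: distinct indices below \<open>m\<close>
      differ by less than \<open>p\<close>.\<close>
    moreover have "\<not> int p dvd int i - int j"
    proof
      assume "int p dvd int i - int j"
      then have "int p \<le> \<bar>int i - int j\<bar>" using False by (intro zdvd_imp_le) auto
      then show False using that mp by linarith
    qed
    ultimately have "\<not> int p dvd 2 * (int i - int j)"
      using p(1) by (simp only: prime_dvd_mult_iff prime_nat_int_transfer simp_thms)
    moreover have "d i - d j = 2 * (int i - int j)" by (simp add: d_def)
    ultimately have "\<not> int p dvd d i - d j" by simp
    then show ?thesis using prime_inverse_mod[OF p(1)] by blast
  qed auto
  then obtain e where e: "[(d i - d j) * e i j = 1] (mod int p)" if "i < m" "j < m" "i \<noteq> j" for i j
    by metis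
  have Xc: "X \<in> carrier_mat m m" using X by (rule traceless_carrier)
  \<comment> \<open>Partial sums of the diagonal of \<open>X\<close>, to be recovered by the
    differences in \<open>bracket_off_diagonals\<close>.\<close>
  define s where "s j = (\<Sum>l\<le>j. X $$ (l, l))" for j
  define A where "A = mat m m (\<lambda>(i, j). if i = j then d i else 0)"
  define B where "B = mat m m (\<lambda>(i, j). if i = j then 0 else e i j * X $$ (i, j))"
  define C :: "int mat" where "C = mat m m (\<lambda>(i, j). if j = Suc i then 1 else 0)"
  define D where "D = mat m m (\<lambda>(i, j). if i = Suc j then s j else 0)"
  have car: "A \<in> carrier_mat m m" "B \<in> carrier_mat m m" "C \<in> carrier_mat m m" "D \<in> carrier_mat m m"
    by (simp_all add: A_def B_def C_def D_def)
  \<comment> \<open>For \<open>k = m\<close> this is exactly what the shift by \<open>m - 1\<close>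
    in \<open>d\<close> removes, so \<open>A\<close> has trace zero.\<close>
  have "(\<Sum>i<k. 2 * int i) = int k * (int k - 1)" for k
    by (induction k) (auto simp: algebra_simps)
  then have "(\<Sum>i<m. d i) = 0" by (simp add: d_def sum_subtractf)
  then have tr: "trc A = 0" "trc B = 0" "trc C = 0" "trc D = 0"
    by (simp_all add: trc_def A_def B_def C_def D_def)
  have diag: "[X $$ (i, i) = (if Suc i < m then s i else 0) - (if i = 0 then 0 else s (i - 1))] (mod int p)"
    if i: "i < m" for i
  proof -
    have s: "s i - (if i = 0 then 0 else s (i - 1)) = X $$ (i, i)"
      by (cases i) (simp_all add: s_def)
    show ?thesis
    proof (cases "Suc i < m")
      case False
      then have m: "m = Suc i" using i by simp
      \<comment> \<open>In the last row the bracket lacks the term \<open>s i\<close>, but there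
        \<open>s i\<close> is the whole trace and vanishes modulo \<open>p\<close>.\<close>
      have "int p dvd s i" using X Xc by (simp add: traceless_def trc_def s_def m lessThan_Suc_atMost)
      moreover have "s i = X $$ (i, i) - ((if Suc i < m then s i else 0) - (if i = 0 then 0 else s (i - 1)))"
        using s False by simp
      ultimately show ?thesis by (simp add: cong_iff_dvd_diff)
    qed (use s in simp)
  qed
  have "[X $$ (i, j) = (bracket A B + bracket C D) $$ (i, j)] (mod int p)" if ij: "i < m" "j < m" for i j
  proof -
    have r: "(bracket A B + bracket C D) $$ (i, j) = bracket A B $$ (i, j) + bracket C D $$ (i, j)"
      using car ij by (intro index_add_mat) auto
    have ab: "bracket A B $$ (i, j) = (d i - d j) * B $$ (i, j)"
      unfolding A_def by (rule bracket_diagonal[OF car(2) ij])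
    have cd: "bracket C D $$ (i, j)
        = (if i = j then (if Suc i < m then s i else 0) - (if i = 0 then 0 else s (i - 1)) else 0)"
      unfolding C_def D_def by (rule bracket_off_diagonals[OF ij])
    show ?thesis
    proof (cases "i = j")
      case True
      then show ?thesis using diag[OF ij(1)] unfolding r ab cd by simp
    next
      case False
      then have "[X $$ (i, j) * 1 = X $$ (i, j) * ((d i - d j) * e i j)] (mod int p)"
        by (intro cong_scalar_left cong_sym[OF e] ij)
      then show ?thesis
        unfolding r ab cd using False ij by (simp add: B_def mult.left_commute mult.commute)
    qed
  qed
  then have "mat_cong p X (bracket A B + bracket C D)"
    using Xc car by (subst mat_cong_iff[of _ m]) auto
  then show ?thesis using car tr by (intro that[of A B C D]) (simp_all add: traceless_def)
qed

text \<open>With zero-diagonal \<open>A = (0, s; t, 0)\<close>, the bracket with \<open>(u, v; w, -u)\<close> is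
  \<open>(sw - tv, -2su; 2tu, tv - sw)\<close>.\<close>
lemma traceless_bracket_two:
  assumes p: "prime p" "p > 2" and X: "traceless 2 p X"
  obtains A B where "traceless 2 p A" "traceless 2 p B" "mat_cong p X (bracket A B)"
proof -
  have "odd p" using p prime_odd_nat by blast
  define a b c where "a = X $$ (0, 0)" and "b = X $$ (0, 1)" and "c = X $$ (1, 0)"
  have Xc: "X \<in> carrier_mat 2 2" using X by (rule traceless_carrier)
  have tr: "int p dvd a + X $$ (1, 1)"
    using X Xc by (simp add: traceless_def trc_def a_def numeral_2_eq_2)
  obtain s t u v w where stuvw: "[a = s * w - t * v] (mod int p)"
    "[b = - 2 * (s * u)] (mod int p)" "[c = 2 * (t * u)] (mod int p)"
  proof (cases "int p dvd b \<and> int p dvd c")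
    case True
    \<comment> \<open>Only the diagonal remains modulo \<open>p\<close>; the witness is
      \<open>s = 1\<close>, \<open>w = a\<close> and \<open>t = v = u = 0\<close>.\<close>
    then show ?thesis using that[of 1 a 0 0 0] by (simp add: cong_0_iff)
  next
    case False
    obtain q where "p = 2 * q + 1" using \<open>odd p\<close> by (rule oddE)
    \<comment> \<open>\<open>h\<close> is \<open>(p + 1) / 2\<close>, the inverse of
      \<open>2\<close> modulo \<open>p\<close>.\<close>
    define h where "h = int q + 1"
    have h: "int p = 2 * h - 1" using \<open>p = 2 * q + 1\<close> by (simp add: h_def)
    have bc: "[b = - 2 * (- b * h)] (mod int p)" "[c = 2 * (c * h)] (mod int p)"
      by (auto simp: cong_iff_dvd_diff h algebra_simps intro: dvdI[of _ _ "-b"] dvdI[of _ _ "-c"])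
    \<comment> \<open>With \<open>u = h\<close>, \<open>s = - b\<close> and \<open>t = c\<close> the
      off-diagonal entries are right. The diagonal equation is then linear in \<open>v\<close> and
      \<open>w\<close>: it is solved for \<open>v\<close> if \<open>c\<close> is invertible and for
      \<open>w\<close> if \<open>b\<close> is.\<close>
    show ?thesis
    proof (cases "int p dvd b")
      case True
      then have "\<not> int p dvd c" using False by blast
      then obtain y where y: "[c * y = 1] (mod int p)" using prime_inverse_mod[OF p(1)] by blast
      have "[a * 1 = a * (c * y)] (mod int p)" by (intro cong_scalar_left cong_sym[OF y])
      then show ?thesis using that[of "- b" 0 c "- a * y" h] bc by (simp add: mult.left_commute)
    next
      case False
      then obtain y where y: "[b * y = 1] (mod int p)" using prime_inverse_mod[OF p(1)] by blast
      have "[a * 1 = a * (b * y)] (mod int p)" by (intro cong_scalar_left cong_sym[OF y])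
      then show ?thesis using that[of "- b" "- a * y" c 0 h] bc by (simp add: mult.left_commute)
    qed
  qed
  define A where "A = mat 2 2 (\<lambda>(i, j). if i = j then 0 else if i = 0 then s else t)"
  define B where "B = mat 2 2 (\<lambda>(i, j). if i = j then (if i = 0 then u else - u) else if i = 0 then v else w)"
  have car: "A \<in> carrier_mat 2 2" "B \<in> carrier_mat 2 2" by (simp_all add: A_def B_def)
  have tr0: "trc A = 0" "trc B = 0" by (simp_all add: trc_def A_def B_def numeral_2_eq_2)
  have br: "bracket A B $$ (0, 0) = s * w - t * v" "bracket A B $$ (0, 1) = - 2 * (s * u)"
    "bracket A B $$ (1, 0) = 2 * (t * u)" "bracket A B $$ (1, 1) = - (s * w - t * v)"
    by (simp_all add: index_bracket[OF car] numeral_2_eq_2) (simp_all add: A_def B_def)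
  have "[X $$ (1, 1) = - (s * w - t * v)] (mod int p)"
  proof -
    have "[X $$ (1, 1) = - a] (mod int p)" using tr by (simp add: cong_iff_dvd_diff add.commute)
    also have "[- a = - (s * w - t * v)] (mod int p)" using stuvw(1) by (simp only: cong_minus_minus_iff)
    finally show ?thesis .
  qed
  then have "[X $$ (i, j) = bracket A B $$ (i, j)] (mod int p)" if "i < 2" "j < 2" for i j
  proof -
    have "i = 0 \<or> i = 1" "j = 0 \<or> j = 1" using that by auto
    then show ?thesis
      using \<open>[X $$ (1, 1) = - (s * w - t * v)] (mod int p)\<close> stuvw
      by (elim disjE) (simp_all only: br a_def b_def c_def)
  qed
  then have "mat_cong p X (bracket A B)"
    using Xc car by (subst mat_cong_iff[of _ 2]) auto
  then show ?thesis using car tr0 by (intro that[of A B]) (simp_all add: traceless_def)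
qed

section \<open>Special linear groups over residue rings\<close>

lemma SL_carrier_mat: "A \<in> carrier (SL m N) \<Longrightarrow> A \<in> carrier_mat m m"
  by (simp add: SL_def)

lemma SL_mult_eq: "A \<otimes>\<^bsub>SL m N\<^esub> B = mat_mod N (A * B)"
  and SL_one_eq: "\<one>\<^bsub>SL m N\<^esub> = mat_mod N (1\<^sub>m m)"
  by (simp_all add: SL_def)

lemma mat_mod_in_SL:
  assumes "A \<in> carrier_mat m m" "[det A = 1] (mod int N)" "N > 0"
  shows "mat_mod N A \<in> carrier (SL m N)"
  using assms det_mat_mod[OF assms(1), of N] by (auto simp: SL_def intro: cong_trans)

lemma SL_eqI:
  assumes "A \<in> carrier (SL m N)" "B \<in> carrier (SL m N)" "mat_cong N A B"
  shows "A = B"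
proof -
  have "mat_mod N C = C" if "C \<in> carrier (SL m N)" for C
    using that by (intro eq_matI) (auto simp: SL_def)
  then show ?thesis using assms by (simp add: mat_cong_def)
qed

lemma SL_mult_cong:
  assumes "M dvd N" "A \<in> carrier (SL m N)" "B \<in> carrier (SL m N)"
  shows "mat_cong M (A \<otimes>\<^bsub>SL m N\<^esub> B) (A * B)"
  unfolding SL_mult_eq
  by (intro mat_cong_mat_mod[of _ _ _ m] assms(1) square_mat_closed assms(2,3)[THEN SL_carrier_mat])

lemma SL_one_cong:
  assumes "M dvd N"
  shows "mat_cong M \<one>\<^bsub>SL m N\<^esub> (1\<^sub>m m)"
  unfolding SL_one_eq using assms by (intro mat_cong_mat_mod[of _ _ _ m]) auto

text \<open>\<open>1 + p X\<close> has determinant \<open>1\<close> only modulo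
  \<open>p ^ 2\<close>. The inverse of this determinant modulo \<open>p ^ n\<close> is again
  \<open>1\<close> modulo \<open>p ^ 2\<close>, so scaling one row by it corrects the determinant
  without leaving the class modulo \<open>p ^ 2\<close>.\<close>

lemma lift_lead_SL:
  assumes p: "prime p" and m: "m > 0" and n: "n \<ge> 2" and X: "traceless m p X"
  obtains A where "A \<in> carrier (SL m (p ^ n))" "mat_cong (p\<^sup>2) A (lead m p 1 X)"
proof -
  let ?L = "lead m p 1 X"
  have Xc: "X \<in> carrier_mat m m" using X by (rule traceless_carrier)
  then have L: "?L \<in> carrier_mat m m" by simp
  have "[det ?L = 1 + int p * trc X] (mod (int p)\<^sup>2)" using det_lead[OF Xc, of p 1] by simp
  also have "[1 + int p * trc X = 1] (mod (int p)\<^sup>2)"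
    using X by (simp add: traceless_def cong_iff_dvd_diff power2_eq_square)
  finally have d: "[det ?L = 1] (mod (int p)\<^sup>2)" .
  then have "coprime (det ?L) ((int p)\<^sup>2)" by (metis cong_imp_coprime cong_sym coprime_1_left)
  then have "coprime (det ?L) (int (p ^ n))" by (simp add: coprime_power_right_iff)
  then obtain e where e: "[det ?L * e = 1] (mod int (p ^ n))"
    using cong_solve_coprime_int by blast
  have p2: "(int p)\<^sup>2 dvd int (p ^ n)" using n by (simp add: le_imp_power_dvd)
  have "[1 * e = det ?L * e] (mod (int p)\<^sup>2)" by (intro cong_scalar_right cong_sym[OF d])
  also have "[det ?L * e = 1] (mod (int p)\<^sup>2)" using e p2 by (rule cong_dvd_modulus)
  finally have e1: "[e = 1] (mod (int p)\<^sup>2)" by simp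
  let ?A = "mat_multrow 0 e ?L"
  have A: "?A \<in> carrier_mat m m" using L by simp
  have "[det ?A = 1] (mod int (p ^ n))" using e det_multrow[OF m L, of e] by (simp add: mult.commute)
  then have "mat_mod (p ^ n) ?A \<in> carrier (SL m (p ^ n))"
    using A p by (intro mat_mod_in_SL) (auto simp: prime_gt_0_nat)
  moreover have "mat_cong (p\<^sup>2) (mat_mod (p ^ n) ?A) ?A"
    using A n by (intro mat_cong_mat_mod le_imp_power_dvd)
  moreover have "[?A $$ (i, j) = ?L $$ (i, j)] (mod int (p\<^sup>2))" if "i < m" "j < m" for i j
    using cong_scalar_right[OF e1, of "?L $$ (i, j)"] that L by auto
  then have "mat_cong (p\<^sup>2) ?A ?L" unfolding mat_cong_iff[OF A L] by blast
  ultimately show ?thesis using that mat_cong_trans by blast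
qed

text \<open>By \<open>det_lead\<close> the determinant is \<open>1 + p ^ k * trc X\<close> modulo
  \<open>p ^ (2 * k)\<close>, and \<open>k + 1 \<le> 2 * k\<close>, so determinant \<open>1\<close>
  forces \<open>p\<close> to divide the trace.\<close>

lemma SL_congruence_subgroup_lead:
  assumes p: "prime p" and A: "A \<in> carrier (SL m (p ^ n))" and k: "k \<ge> 1" "k < n"
    and c: "mat_cong (p ^ k) A (1\<^sub>m m)"
  obtains X where "traceless m p X" "A = lead m p k X"
proof -
  obtain X where X: "X \<in> carrier_mat m m" "A = lead m p k X"
    using mat_cong_one_lead[OF SL_carrier_mat[OF A] c] .
  have "[1 = det A] (mod int (p ^ (k + 1)))"
  proof (rule cong_dvd_modulus)
    show "[1 = det A] (mod int (p ^ n))" using A by (simp add: SL_def cong_sym)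
    show "int (p ^ (k + 1)) dvd int (p ^ n)"
      using k by (intro of_nat_dvd_iff[THEN iffD2] le_imp_power_dvd) simp
  qed
  also have "[det A = 1 + int (p ^ k) * trc X] (mod int (p ^ (k + 1)))"
    unfolding X(2)
  proof (rule cong_dvd_modulus[OF det_lead[OF X(1)]])
    have "(int (p ^ k))\<^sup>2 = int (p ^ (2 * k))" by (simp add: power_mult[symmetric] mult.commute)
    then show "int (p ^ (k + 1)) dvd (int (p ^ k))\<^sup>2"
      using k by (simp only:) (intro of_nat_dvd_iff[THEN iffD2] le_imp_power_dvd, simp)
  qed
  finally have "int p ^ k * int p dvd int p ^ k * trc X"
    by (simp add: cong_iff_dvd_diff mult.commute)
  then have "int p dvd trc X" using p by (simp add: prime_gt_0_nat)
  then show ?thesis using that X by (simp add: traceless_def)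
qed

text \<open>Already the elementary matrices with a residue at position \<open>(0, 1)\<close> are
  \<open>N\<close> in number.\<close>

lemma card_SL_ge:
  assumes "m \<ge> 2" "N > 0"
  shows "card (carrier (SL m N)) \<ge> N"
proof -
  let ?A = "\<lambda>x. mat_mod N (addrow_mat m (int x) 0 1)"
  have "?A x \<in> carrier (SL m N)" for x
    using det_addrow_mat[of 0 1 m "int x"] assms by (intro mat_mod_in_SL) (auto simp: addrow_mat_def)
  moreover have "inj_on ?A {..<N}"
  proof (rule inj_onI)
    fix x y assume xy: "x \<in> {..<N}" "y \<in> {..<N}" "?A x = ?A y"
    have "?A z $$ (0, 1) = int z" if "z < N" for z
      using that assms by (simp add: addrow_mat_def)
    then show "x = y" using xy by (metis lessThan_iff of_nat_eq_iff)
  qed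
  ultimately have "card {..<N} \<le> card (carrier (SL m N))"
    by (intro card_inj_on_le[of ?A] finite_SL) auto
  then show ?thesis by simp
qed

section \<open>Words in a group\<close>

definition word_ball :: "('a, 'b) monoid_scheme \<Rightarrow> 'a set \<Rightarrow> nat \<Rightarrow> 'a set" where
  "word_ball G S k = {foldr (\<otimes>\<^bsub>G\<^esub>) ws \<one>\<^bsub>G\<^esub> | ws. set ws \<subseteq> S \<union> set_inv\<^bsub>G\<^esub> S \<and> length ws \<le> k}"

lemma word_ball_mono: "k \<le> l \<Longrightarrow> g \<in> word_ball G S k \<Longrightarrow> g \<in> word_ball G S l"
  unfolding word_ball_def by fastforce

lemma diam_le:
  assumes "carrier G \<subseteq> word_ball G S k"
  shows "diam G S \<le> k"
proof -
  have "\<forall>g \<in> carrier G. \<exists>ws.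
     set ws \<subseteq> S \<union> set_inv\<^bsub>G\<^esub> S \<and> length ws \<le> k \<and> foldr (\<otimes>\<^bsub>G\<^esub>) ws \<one>\<^bsub>G\<^esub> = g"
    using assms unfolding word_ball_def by blast
  then show ?thesis unfolding diam_def by (rule Least_le)
qed

context group
begin

lemma foldr_mult_closed:
  "set ws \<subseteq> carrier G \<Longrightarrow> foldr (\<otimes>) ws \<one> \<in> carrier G"
  by (induction ws) auto

lemma foldr_mult_append:
  "set us \<subseteq> carrier G \<Longrightarrow> set vs \<subseteq> carrier G \<Longrightarrow>
    foldr (\<otimes>) (us @ vs) \<one> = foldr (\<otimes>) us \<one> \<otimes> foldr (\<otimes>) vs \<one>"
  by (induction us) (auto simp: foldr_mult_closed m_assoc)

lemma foldr_mult_inv: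
  "set ws \<subseteq> carrier G \<Longrightarrow>
    foldr (\<otimes>) (rev (map (m_inv G) ws)) \<one> = inv (foldr (\<otimes>) ws \<one>)"
proof (induction ws)
  case (Cons w ws)
  then have w: "w \<in> carrier G" and ws: "set ws \<subseteq> carrier G" by auto
  have "foldr (\<otimes>) (rev (map (m_inv G) ws) @ [inv w]) \<one>
    = foldr (\<otimes>) (rev (map (m_inv G) ws)) \<one> \<otimes> foldr (\<otimes>) [inv w] \<one>"
    using w ws by (intro foldr_mult_append) auto
  then show ?case
    using Cons.IH[OF ws] w foldr_mult_closed[OF ws] by (simp add: inv_mult_group)
qed simp

context
  fixes S
  assumes S: "S \<subseteq> carrier G"
begin

lemma gens_closed: "S \<union> set_inv S \<subseteq> carrier G"
  using S by (auto simp: SET_INV_def)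

lemma word_ball_closed: "g \<in> word_ball G S k \<Longrightarrow> g \<in> carrier G"
  using gens_closed by (auto simp: word_ball_def intro!: foldr_mult_closed)

lemma word_ball_mult:
  assumes "g \<in> word_ball G S k" "h \<in> word_ball G S l"
  shows "g \<otimes> h \<in> word_ball G S (k + l)"
proof -
  obtain us vs where "set us \<subseteq> S \<union> set_inv S" "length us \<le> k" "g = foldr (\<otimes>) us \<one>"
    "set vs \<subseteq> S \<union> set_inv S" "length vs \<le> l" "h = foldr (\<otimes>) vs \<one>"
    using assms by (auto simp: word_ball_def)
  moreover from this have "foldr (\<otimes>) (us @ vs) \<one> = g \<otimes> h"
    using foldr_mult_append[of us vs] gens_closed by (metis subset_trans)
  ultimately show ?thesis
    unfolding word_ball_def by (intro CollectI exI[of _ "us @ vs"]) (auto simp del: foldr_append)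
qed

lemma word_ball_inv:
  assumes "g \<in> word_ball G S k"
  shows "inv g \<in> word_ball G S k"
proof -
  obtain ws where ws: "set ws \<subseteq> S \<union> set_inv S" "length ws \<le> k" "g = foldr (\<otimes>) ws \<one>"
    using assms by (auto simp: word_ball_def)
  have "m_inv G ` (S \<union> set_inv S) \<subseteq> S \<union> set_inv S"
    using S by (auto simp: SET_INV_def)
  then have "set (rev (map (m_inv G) ws)) \<subseteq> S \<union> set_inv S" using ws(1) by auto
  moreover have "set ws \<subseteq> carrier G" using ws(1) gens_closed by (rule subset_trans)
  ultimately show ?thesis
    using ws foldr_mult_inv[of ws] unfolding word_ball_def
    by (intro CollectI exI[of _ "rev (map (m_inv G) ws)"]) auto
qed

text \<open>In a shortest word for the class of \<open>g\<close>, no two suffixes have the same class, since the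
  longer one could be replaced by the shorter one.\<close>
lemma word_ball_represents:
  assumes fin: "finite (carrier G)" and gen: "generate G S = carrier G"
    and T: "finite T" "f ` carrier G \<subseteq> T"
    and f: "\<And>x g h. x \<in> carrier G \<Longrightarrow> g \<in> carrier G \<Longrightarrow> h \<in> carrier G \<Longrightarrow> f g = f h
      \<Longrightarrow> f (x \<otimes> g) = f (x \<otimes> h)"
    and g: "g \<in> carrier G"
  shows "\<exists>h \<in> word_ball G S (card T). f h = f g"
proof -
  let ?val = "\<lambda>ws. foldr (\<otimes>) ws \<one>"
  let ?P = "\<lambda>k. \<exists>ws. set ws \<subseteq> S \<union> set_inv S \<and> length ws = k \<and> f (?val ws) = f g"
  have "\<exists>k. ?P k" using diam_LEAST_nonempty[OF fin S gen] g by metis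
  then have least: "?P (LEAST k. ?P k)" by (rule LeastI_ex)
  define k where "k = (LEAST k. ?P k)"
  obtain ws where ws: "set ws \<subseteq> S \<union> set_inv S" "length ws = k" "f (?val ws) = f g"
    using least unfolding k_def by blast
  have car: "set us \<subseteq> carrier G" if "set us \<subseteq> set ws" for us
    using that ws(1) gens_closed by blast
  have sub: "set (drop i ws) \<subseteq> set ws" "set (take i ws) \<subseteq> set ws" for i
    by (rule set_drop_subset, rule set_take_subset)
  have neq: "f (?val (drop i ws)) \<noteq> f (?val (drop j ws))" if "i < j" "j \<le> k" for i j
  proof
    assume "f (?val (drop i ws)) = f (?val (drop j ws))"
    then have "f (?val (take i ws) \<otimes> ?val (drop i ws)) = f (?val (take i ws) \<otimes> ?val (drop j ws))"
      by (intro f foldr_mult_closed car sub)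
    also have "?val (take i ws) \<otimes> ?val (drop i ws) = ?val ws"
      using foldr_mult_append[OF car[OF sub(2)] car[OF sub(1)], of i i] by simp
    finally have "f (?val (take i ws @ drop j ws)) = f g"
      using foldr_mult_append[OF car[OF sub(2)] car[OF sub(1)], of i j] ws(3) by simp
    moreover have "set (take i ws @ drop j ws) \<subseteq> S \<union> set_inv S"
      using sub[of i] sub[of j] ws(1) unfolding set_append by blast
    ultimately have "?P (length (take i ws @ drop j ws))" by blast
    then have "k \<le> length (take i ws @ drop j ws)" unfolding k_def by (rule Least_le)
    then show False using that ws(2) by simp
  qed
  \<comment> \<open>The \<open>k + 1\<close> suffixes, from the whole word to the empty one, have
    distinct classes in \<open>T\<close>.\<close>
  have "inj_on (\<lambda>i. f (?val (drop i ws))) {..k}"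
    by (rule linorder_inj_onI) (use neq in auto)
  moreover have "(\<lambda>i. f (?val (drop i ws))) ` {..k} \<subseteq> T"
    using T(2) foldr_mult_closed[OF car[OF sub(1)]] by blast
  ultimately have "card {..k} \<le> card T" using T(1) by (rule card_inj_on_le)
  then have "?val ws \<in> word_ball G S (card T)"
    using ws unfolding word_ball_def by auto
  then show ?thesis using ws(3) by blast
qed

end

end

section \<open>Leading terms reached by short words\<close>

text \<open>For \<open>N = p ^ 2\<close> the cardinality serves as the base word length, independent
  of \<open>n\<close> and of the generators.\<close>

definition residue_mats :: "nat \<Rightarrow> nat \<Rightarrow> int mat set" where
  "residue_mats m N = {A \<in> carrier_mat m m. \<forall>i<m. \<forall>j<m. A $$ (i, j) \<in> {0..<int N}}"

lemma finite_residue_mats: "finite (residue_mats m N)"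
proof -
  have "residue_mats m N \<subseteq> (\<lambda>f. mat m m f) ` (({0..<m} \<times> {0..<m}) \<rightarrow>\<^sub>E {0..<int N})"
  proof
    fix A assume "A \<in> residue_mats m N"
    then have A: "A \<in> carrier_mat m m" "\<forall>i<m. \<forall>j<m. A $$ (i, j) \<in> {0..<int N}"
      by (auto simp: residue_mats_def)
    let ?f = "restrict (\<lambda>ij. A $$ ij) ({0..<m} \<times> {0..<m})"
    have "A = mat m m ?f" using A(1) by (intro eq_matI) auto
    moreover have "?f \<in> ({0..<m} \<times> {0..<m}) \<rightarrow>\<^sub>E {0..<int N}" using A(2) by auto
    ultimately show "A \<in> (\<lambda>f. mat m m f) ` (({0..<m} \<times> {0..<m}) \<rightarrow>\<^sub>E {0..<int N})" by blast
  qed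
  then show ?thesis by (rule finite_subset) (intro finite_imageI finite_PiE; simp)
qed

locale SL_generators =
  fixes m p n :: nat and S :: "int mat set"
  assumes p: "prime p" and m: "m > 0" and n: "n > 0"
    and S: "S \<subseteq> carrier (SL m (p ^ n))" and gen: "generate (SL m (p ^ n)) S = carrier (SL m (p ^ n))"
begin

abbreviation G where "G \<equiv> SL m (p ^ n)"

lemma p_pos: "p > 0"
  using p by (rule prime_gt_0_nat)

sublocale group G
  using p_pos by (intro group_SL) simp

abbreviation ball where "ball \<equiv> word_ball G S"

abbreviation base_length where "base_length \<equiv> card (residue_mats m (p\<^sup>2))"

lemmas ball_closed = word_ball_closed[OF S]
  and ball_mult = word_ball_mult[OF S]
  and ball_inv = word_ball_inv[OF S]

text \<open>Reductions modulo \<open>p\<close> and modulo \<open>p ^ 2\<close> both land in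
  \<open>residue_mats m (p ^ 2)\<close>, so one length serves for the start of the approximation and
  for level \<open>1\<close>.\<close>

lemma ball_near:
  assumes g: "g \<in> carrier G" and k: "k \<le> 2" "k \<le> n"
  shows "\<exists>h \<in> ball base_length. mat_cong (p ^ k) h g"
  unfolding mat_cong_def
proof (rule word_ball_represents[OF S finite_SL gen finite_residue_mats _ _ g])
  have "p ^ k \<le> p\<^sup>2" using k p_pos by (intro power_increasing) auto
  moreover have "x mod int (p ^ k) < int (p ^ k)" for x using p_pos by simp
  ultimately have "x mod int (p ^ k) < int (p\<^sup>2)" for x
    by (meson less_le_trans of_nat_le_iff)
  then show "mat_mod (p ^ k) ` carrier G \<subseteq> residue_mats m (p\<^sup>2)"
    using p_pos by (auto simp: residue_mats_def dest!: SL_carrier_mat)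
next
  have d: "p ^ k dvd p ^ n" using k by (simp add: le_imp_power_dvd)
  fix x g h assume c: "x \<in> carrier G" "g \<in> carrier G" "h \<in> carrier G"
    and "mat_mod (p ^ k) g = mat_mod (p ^ k) h"
  then have "mat_cong (p ^ k) (x * g) (x * h)"
    by (intro mat_cong_mult[of _ _ _ _ _ m]) (auto simp: mat_cong_def dest: SL_carrier_mat)
  then show "mat_mod (p ^ k) (x \<otimes>\<^bsub>G\<^esub> g) = mat_mod (p ^ k) (x \<otimes>\<^bsub>G\<^esub> h)"
    using SL_mult_cong[OF d c(1,2)] SL_mult_cong[OF d c(1,3)] by (simp add: mat_cong_def)
qed

text \<open>The invariant of the recursion. One length serves all leading terms, so the factors of a
  bracket may be chosen freely.\<close>

definition hits :: "nat \<Rightarrow> nat \<Rightarrow> bool" where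
  "hits k l \<longleftrightarrow> (\<forall>X. traceless m p X \<longrightarrow> (\<exists>g \<in> ball l. mat_cong (p ^ (k + 1)) g (lead m p k X)))"

lemma hitsE:
  assumes "hits k l" "traceless m p X"
  obtains g where "g \<in> ball l" "mat_cong (p ^ (k + 1)) g (lead m p k X)"
  using assms unfolding hits_def by blast

lemma hits_mono: "hits k l \<Longrightarrow> l \<le> l' \<Longrightarrow> hits k l'"
  unfolding hits_def using word_ball_mono by metis

text \<open>Commutators of positive levels never produce level \<open>1\<close>, so here a lift to
  the group is replaced by a short word in the same class modulo \<open>p ^ 2\<close>.\<close>

lemma hits_one:
  assumes "n \<ge> 2"
  shows "hits 1 base_length"
  unfolding hits_def
proof (intro allI impI)
  fix X assume "traceless m p X"
  then obtain A where A: "A \<in> carrier G" "mat_cong (p\<^sup>2) A (lead m p 1 X)"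
    using lift_lead_SL[OF p m assms] by blast
  then show "\<exists>g\<in>ball base_length. mat_cong (p ^ (1 + 1)) g (lead m p 1 X)"
    using ball_near[OF A(1), of 2] assms mat_cong_trans by (metis one_add_one order_refl)
qed

lemma mult_inv_cong:
  assumes "M dvd p ^ n" "g \<in> carrier G"
  shows "mat_cong M (g * inv\<^bsub>G\<^esub> g) (1\<^sub>m m)"
  using mat_cong_trans[OF mat_cong_sym[OF SL_mult_cong[OF assms inv_closed[OF assms(2)]]]]
    SL_one_cong[OF assms(1)] r_inv[OF assms(2)] by simp

text \<open>The factor \<open>4\<close> is the length of a commutator in its two entries and their
  inverses.\<close>

lemma hits_bracket:
  assumes "hits a l" "hits b l" and ab: "a \<ge> 1" "b \<ge> 1" "a + b < n"
    and X: "traceless m p X" and Y: "traceless m p Y"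
  obtains g where "g \<in> ball (4 * l)" "mat_cong (p ^ (a + b + 1)) g (lead m p (a + b) (bracket X Y))"
proof -
  obtain U where U: "U \<in> ball l" "mat_cong (p ^ (a + 1)) U (lead m p a X)"
    using hitsE[OF assms(1) X] .
  obtain V where V: "V \<in> ball l" "mat_cong (p ^ (b + 1)) V (lead m p b Y)"
    using hitsE[OF assms(2) Y] .
  note c = ball_closed[OF U(1)] ball_closed[OF V(1)]
  note car = SL_carrier_mat[OF c(1)] SL_carrier_mat[OF c(2)]
    SL_carrier_mat[OF inv_closed[OF c(1)]] SL_carrier_mat[OF inv_closed[OF c(2)]]
  have d: "p ^ (a + b + 1) dvd p ^ n" using ab by (intro le_imp_power_dvd) simp
  let ?g = "U \<otimes>\<^bsub>G\<^esub> V \<otimes>\<^bsub>G\<^esub> (inv\<^bsub>G\<^esub> U \<otimes>\<^bsub>G\<^esub> inv\<^bsub>G\<^esub> V)"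
  have "?g \<in> ball ((l + l) + (l + l))"
    by (intro ball_mult ball_inv U V)
  moreover have "mat_cong (p ^ (a + b + 1)) ?g (lead m p (a + b) (bracket X Y))"
  proof -
    have "mat_cong (p ^ (a + b + 1)) ?g ((U \<otimes>\<^bsub>G\<^esub> V) * (inv\<^bsub>G\<^esub> U \<otimes>\<^bsub>G\<^esub> inv\<^bsub>G\<^esub> V))"
      by (intro SL_mult_cong d m_closed inv_closed c)
    also have "mat_cong (p ^ (a + b + 1)) \<dots> (U * V * (inv\<^bsub>G\<^esub> U * inv\<^bsub>G\<^esub> V))"
      by (intro mat_cong_mult[of _ _ _ _ _ m] SL_mult_cong d inv_closed c SL_carrier_mat[of _ _ "p ^ n"]
          m_closed square_mat_closed)
    also have "mat_cong (p ^ (a + b + 1)) \<dots> (lead m p (a + b) (bracket X Y))"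
      by (intro mat_cong_commutator car U V ab p_pos mult_inv_cong d c traceless_carrier[OF X] traceless_carrier[OF Y])
    finally show ?thesis .
  qed
  moreover have "(l + l) + (l + l) = 4 * l" by simp
  ultimately show ?thesis by (intro that[of ?g]) (simp_all only:)
qed

text \<open>A product of two commutators, each of length \<open>4 * l\<close>, adds their leading
  terms. The factor is written as a power of \<open>2\<close> because its exponent becomes the
  degree of the length bound.\<close>

lemma hits_add_two_brackets:
  assumes h: "hits a l" "hits b l" and ab: "a \<ge> 1" "b \<ge> 1" "a + b < n" and mp: "p > 2" "m \<le> p"
  shows "hits (a + b) (2 ^ 3 * l)"
  unfolding hits_def
proof (intro allI impI)
  fix X assume X: "traceless m p X"
  obtain A B C D where t: "traceless m p A" "traceless m p B" "traceless m p C" "traceless m p D"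
    and c: "mat_cong p X (bracket A B + bracket C D)"
    using traceless_two_brackets[OF p mp X] .
  note car = t[THEN traceless_carrier]
  let ?k = "a + b"
  obtain g where g: "g \<in> ball (4 * l)" "mat_cong (p ^ (?k + 1)) g (lead m p ?k (bracket A B))"
    using hits_bracket[OF h ab t(1,2)] .
  obtain h where h: "h \<in> ball (4 * l)" "mat_cong (p ^ (?k + 1)) h (lead m p ?k (bracket C D))"
    using hits_bracket[OF h ab t(3,4)] .
  have d: "p ^ (?k + 1) dvd p ^ n" using ab by (intro le_imp_power_dvd) simp
  have "mat_cong (p ^ (?k + 1)) (g \<otimes>\<^bsub>G\<^esub> h) (g * h)"
    by (intro SL_mult_cong d ball_closed[OF g(1)] ball_closed[OF h(1)])
  also have "mat_cong (p ^ (?k + 1)) \<dots> (lead m p ?k (bracket A B) * lead m p ?k (bracket C D))"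
    by (intro mat_cong_mult[of _ _ _ _ _ m] g(2) h(2) SL_carrier_mat[of _ _ "p ^ n"]
        ball_closed[OF g(1)] ball_closed[OF h(1)] lead_carrier square_mat_closed car)
  also have "mat_cong (p ^ (?k + 1)) \<dots> (lead m p ?k (bracket A B + bracket C D))"
    using ab by (intro lead_mult_cong square_mat_closed car) simp
  also have "mat_cong (p ^ (?k + 1)) \<dots> (lead m p ?k X)"
    by (intro mat_cong_lead mat_cong_sym[OF c] traceless_carrier[OF X] add_carrier_mat square_mat_closed car)
  finally show "\<exists>g\<in>ball (2 ^ 3 * l). mat_cong (p ^ (?k + 1)) g (lead m p ?k X)"
    using ball_mult[OF g(1) h(1)] by (intro bexI[of _ "g \<otimes>\<^bsub>G\<^esub> h"]) auto
qed

lemma hits_add_one_bracket: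
  assumes h: "hits a l" "hits b l" and ab: "a \<ge> 1" "b \<ge> 1" "a + b < n" and mp: "p > 2" "m = 2"
  shows "hits (a + b) (2 ^ 2 * l)"
  unfolding hits_def
proof (intro allI impI)
  fix X assume X: "traceless m p X"
  obtain A B where t: "traceless m p A" "traceless m p B" and c: "mat_cong p X (bracket A B)"
    using traceless_bracket_two[OF p mp(1)] X mp(2) by metis
  obtain g where g: "g \<in> ball (4 * l)" "mat_cong (p ^ (a + b + 1)) g (lead m p (a + b) (bracket A B))"
    using hits_bracket[OF h ab t] .
  note g(2)
  also have "mat_cong (p ^ (a + b + 1)) (lead m p (a + b) (bracket A B)) (lead m p (a + b) X)"
    by (intro mat_cong_lead mat_cong_sym[OF c] traceless_carrier[OF X] square_mat_closed t[THEN traceless_carrier])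
  finally show "\<exists>g\<in>ball (2 ^ 2 * l). mat_cong (p ^ (a + b + 1)) g (lead m p (a + b) X)"
    using g(1) by (intro bexI[of _ g]) auto
qed

section \<open>Recursion over the levels for an abstract cost exponent \<open>e\<close>\<close>

context
  fixes e :: nat
  assumes hits_add: "\<And>a b l. hits a l \<Longrightarrow> hits b l \<Longrightarrow> a \<ge> 1 \<Longrightarrow> b \<ge> 1 \<Longrightarrow> a + b < n
    \<Longrightarrow> hits (a + b) (2 ^ e * l)"
begin

abbreviation base_const where "base_const \<equiv> 2 ^ e * base_length"

text \<open>Halving \<open>k\<close> costs a factor \<open>2 ^ e\<close>; measuring by \<open>k - 1\<close> instead of \<open>k\<close> absorbs the
  rounding for odd \<open>k\<close>.\<close>
lemma hits_polynomial_pred: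
  assumes "k \<ge> 2" "k < n"
  shows "hits k (base_const * (k - 1) ^ e)"
  using assms
proof (induction k rule: less_induct)
  case (less k)
  have one: "hits 1 base_length" using less.prems by (intro hits_one) simp
  show ?case
  proof (cases "k = 2")
    case True
    then show ?thesis using hits_add[OF one one] less.prems unfolding one_add_one by simp
  next
    case False
    define a b where "a = k div 2" and "b = k - k div 2"
    have ab: "a + b = k" "a \<ge> 1" "b \<ge> 2" "a \<le> b" "b < k" "2 * (b - 1) \<le> k - 1"
      using False less.prems by (auto simp: a_def b_def)
    let ?l = "base_const * (b - 1) ^ e"
    have b: "hits b ?l" using ab less.prems by (intro less.IH) auto
    have a: "hits a ?l"
    proof (cases "a = 1")
      case True
      have "1 * base_length * 1 \<le> ?l" using ab by (intro mult_le_mono) auto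
      then show ?thesis using hits_mono[OF one] True by simp
    next
      case False
      then have "hits a (base_const * (a - 1) ^ e)" using ab less.prems by (intro less.IH) auto
      moreover have "base_const * (a - 1) ^ e \<le> ?l" using ab by (intro mult_le_mono2 power_mono) auto
      ultimately show ?thesis by (rule hits_mono)
    qed
    have "hits k (2 ^ e * ?l)" using hits_add[OF a b] ab less.prems by simp
    moreover have "2 ^ e * ?l = base_const * (2 * (b - 1)) ^ e"
      by (simp only: power_mult_distrib ac_simps)
    moreover have "\<dots> \<le> base_const * (k - 1) ^ e"
      using ab by (intro mult_le_mono2 power_mono) auto
    ultimately show ?thesis using hits_mono by metis
  qed
qed

lemma hits_polynomial:
  assumes "k \<ge> 1" "k < n"
  shows "hits k (base_const * n ^ e)"
proof (cases "k = 1")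
  case True
  have "1 * base_length * 1 \<le> base_const * n ^ e" using n by (intro mult_le_mono) auto
  then show ?thesis using hits_mono[OF hits_one] True assms by simp
next
  case False
  have "base_const * (k - 1) ^ e \<le> base_const * n ^ e"
    using assms by (intro mult_le_mono2 power_mono) auto
  then show ?thesis using hits_mono[OF hits_polynomial_pred] False assms by simp
qed

text \<open>If \<open>h\<close> agrees with \<open>g\<close> modulo \<open>p ^ j\<close>, the error
  \<open>inv h * g\<close> has a traceless leading term at level \<open>j\<close>. A short word
  \<open>w\<close> with this leading term makes \<open>h * w\<close> agree with \<open>g\<close>
  modulo \<open>p ^ (j + 1)\<close>.\<close>

lemma ball_approximates:
  assumes g: "g \<in> carrier G" and "k < n"
  shows "\<exists>h \<in> ball (Suc k * (base_const * n ^ e)). mat_cong (p ^ Suc k) h g"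
  using assms(2)
proof (induction k)
  case 0
  have "1 * base_length * 1 \<le> base_const * n ^ e" using n by (intro mult_le_mono) auto
  moreover obtain h where "h \<in> ball base_length" "mat_cong (p ^ 1) h g"
    using ball_near[OF g, of 1] n by auto
  ultimately show ?case
    using word_ball_mono[of base_length "base_const * n ^ e" h] by (intro bexI[of _ h]) simp_all
next
  case (Suc k)
  let ?l = "base_const * n ^ e" and ?k = "Suc k"
  obtain h where h: "h \<in> ball (?k * ?l)" "mat_cong (p ^ ?k) h g" using Suc by auto
  note hc = ball_closed[OF h(1)]
  have d: "p ^ j dvd p ^ n" if "j \<le> n" for j using that by (rule le_imp_power_dvd)
  note car = SL_carrier_mat[OF hc] SL_carrier_mat[OF inv_closed[OF hc]] SL_carrier_mat[OF g]
  let ?r = "inv\<^bsub>G\<^esub> h \<otimes>\<^bsub>G\<^esub> g"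
  have rc: "?r \<in> carrier G" using hc g by simp
  have "mat_cong (p ^ ?k) ?r (inv\<^bsub>G\<^esub> h * g)"
    using Suc.prems by (intro SL_mult_cong d inv_closed hc g) simp
  also have "mat_cong (p ^ ?k) \<dots> (inv\<^bsub>G\<^esub> h * h)"
    by (intro mat_cong_mult[of _ _ _ _ _ m] mat_cong_refl mat_cong_sym[OF h(2)] car)
  also have "mat_cong (p ^ ?k) \<dots> (1\<^sub>m m)"
    using mult_inv_cong[OF d inv_closed[OF hc], of ?k] Suc.prems hc by simp
  finally have r1: "mat_cong (p ^ ?k) ?r (1\<^sub>m m)" .
  have k1: "1 \<le> ?k" by simp
  obtain X where X: "traceless m p X" "?r = lead m p ?k X"
    using SL_congruence_subgroup_lead[OF p rc k1 Suc.prems r1] .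
  obtain w where w: "w \<in> ball ?l" "mat_cong (p ^ (?k + 1)) w ?r"
    using hitsE[OF hits_polynomial[OF k1 Suc.prems] X(1)] unfolding X(2) .
  have d': "p ^ (?k + 1) dvd p ^ n" using Suc.prems by (intro d) simp
  have "mat_cong (p ^ (?k + 1)) (h \<otimes>\<^bsub>G\<^esub> w) (h * w)"
    by (intro SL_mult_cong d' hc ball_closed[OF w(1)])
  also have "mat_cong (p ^ (?k + 1)) \<dots> (h * ?r)"
    by (intro mat_cong_mult[of _ _ _ _ _ m] mat_cong_refl w(2) car SL_carrier_mat[OF rc]
        SL_carrier_mat[OF ball_closed[OF w(1)]])
  also have "mat_cong (p ^ (?k + 1)) \<dots> (h \<otimes>\<^bsub>G\<^esub> ?r)"
    by (intro mat_cong_sym[OF SL_mult_cong] d' hc rc)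
  also have "h \<otimes>\<^bsub>G\<^esub> ?r = g" using hc g by (simp add: m_assoc[symmetric])
  finally have "mat_cong (p ^ (?k + 1)) (h \<otimes>\<^bsub>G\<^esub> w) g" .
  moreover have "h \<otimes>\<^bsub>G\<^esub> w \<in> ball (Suc ?k * ?l)"
    using ball_mult[OF h(1) w(1)] by (simp add: add.commute)
  ultimately show ?case by auto
qed

lemma diam_polynomial: "diam G S \<le> base_const * n ^ Suc e"
proof (rule diam_le, rule subsetI)
  fix g assume g: "g \<in> carrier G"
  \<comment> \<open>Step \<open>n - 1\<close> reaches the modulus \<open>p ^ n\<close>, at which
    congruent group elements are equal.\<close>
  obtain h where h: "h \<in> ball (n * (base_const * n ^ e))" "mat_cong (p ^ n) h g"
    using ball_approximates[OF g, of "n - 1"] n by auto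
  then have "h = g" using SL_eqI[OF ball_closed[OF h(1)] g] by blast
  then show "g \<in> ball (base_const * n ^ Suc e)" using h(1) by (simp add: mult.left_commute)
qed

end

end

section \<open>From powers of \<open>n\<close> to powers of the logarithm of the group order\<close>

lemma diam_worst_SL_le:
  assumes "prime p" "m > 0" "n > 0"
    and "\<And>S. SL_generators m p n S \<Longrightarrow> diam (SL m (p ^ n)) S \<le> k"
  shows "diam_worst (SL m (p ^ n)) \<le> k"
proof -
  interpret group "SL m (p ^ n)" using assms(1) by (intro group_SL) (simp add: prime_gt_0_nat)
  show ?thesis
    unfolding diam_worst_def
    using diam_worst_Max_nonempty[OF finite_SL] assms by (subst Max_le_iff) (auto simp: SL_generators_def)
qed

text \<open>From \<open>2 ^ n \<le> p ^ n \<le> |G_n|\<close> follows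
  \<open>n \<le> log 2 |G_n|\<close>; since \<open>n \<ge> 1\<close>, the exponent \<open>e\<close>
  may be raised to \<open>d\<close>.\<close>

lemma polynomial_le_log_order_powr:
  fixes p m n e c :: nat and d :: real
  assumes p: "prime p" and m: "m \<ge> 2" and n: "n \<ge> 1" and d: "d > real e" and k: "k \<le> c * n ^ e"
  shows "real k \<le> real c * log 2 (real (Coset.order (SL m (p ^ n)))) powr d"
proof -
  have "(2::nat) ^ n \<le> p ^ n" using p by (intro power_mono prime_ge_2_nat) auto
  also have "\<dots> \<le> Coset.order (SL m (p ^ n))"
    unfolding Coset.order_def using m p by (intro card_SL_ge) (auto simp: prime_gt_0_nat)
  finally have "real (2 ^ n) \<le> real (Coset.order (SL m (p ^ n)))" by (simp only: of_nat_le_iff)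
  then have log: "real n \<le> log 2 (real (Coset.order (SL m (p ^ n))))"
    by (simp add: le_log_of_power)
  have "real k \<le> real c * real n ^ e" using k by (metis of_nat_le_iff of_nat_mult of_nat_power)
  also have "real n ^ e = real n powr real e" using n by (simp add: powr_realpow)
  also have "real n powr real e \<le> real n powr d" using n d by (intro powr_mono) auto
  also have "real n powr d \<le> log 2 (real (Coset.order (SL m (p ^ n)))) powr d"
    using log d n by (intro powr_mono2) auto
  finally show ?thesis by (simp add: mult_left_mono)
qed

text \<open>Two brackets give \<open>e = 3\<close>, and the \<open>n\<close> successive corrections
  add one more to the exponent.\<close>

lemma diam_worst_SL_log_order:
  assumes pp: "prime p" "p > 2" and mp: "m \<ge> 2" "m \<le> p" and d: "d > (4::real)"
  shows "\<exists>C::real. \<forall>n\<ge>1.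
    real (diam_worst (SL m (p ^ n))) \<le> C * log 2 (real (Coset.order (SL m (p ^ n)))) powr d"
proof (intro exI allI impI)
  fix n :: nat assume n: "n \<ge> 1"
  \<comment> \<open>The witness for \<open>C\<close> was left schematic before \<open>n\<close> was
    fixed; this number involves only \<open>m\<close> and \<open>p\<close>.\<close>
  let ?c = "2 ^ 3 * card (residue_mats m (p\<^sup>2))"
  have "diam_worst (SL m (p ^ n)) \<le> ?c * n ^ 4"
  proof (rule diam_worst_SL_le)
    fix S assume "SL_generators m p n S"
    then interpret SL_generators m p n S .
    show "diam G S \<le> ?c * n ^ 4"
      using diam_polynomial[of 3] hits_add_two_brackets pp(2) mp(2) by simp
  qed (use pp mp n in auto)
  then show "real (diam_worst (SL m (p ^ n))) \<le> real ?c * log 2 (real (Coset.order (SL m (p ^ n)))) powr d"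
    using pp mp n d by (intro polynomial_le_log_order_powr[of _ _ _ 4]) auto
qed

text \<open>For \<open>m = 2\<close> a single bracket suffices, so \<open>e = 2\<close> and the
  bound is cubic in \<open>n\<close>.\<close>

lemma diam_worst_SL2_log_order:
  assumes pp: "prime p" "p > 2" and d: "d > (3::real)"
  shows "\<exists>C::real. \<forall>n\<ge>1.
    real (diam_worst (SL 2 (p ^ n))) \<le> C * log 2 (real (Coset.order (SL 2 (p ^ n)))) powr d"
proof (intro exI allI impI)
  fix n :: nat assume n: "n \<ge> 1"
  let ?c = "2 ^ 2 * card (residue_mats 2 (p\<^sup>2))"
  have "diam_worst (SL 2 (p ^ n)) \<le> ?c * n ^ 3"
  proof (rule diam_worst_SL_le)
    fix S assume "SL_generators 2 p n S"
    then interpret SL_generators 2 p n S .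
    show "diam G S \<le> ?c * n ^ 3"
      using diam_polynomial[of 2] hits_add_one_bracket pp(2) by (simp add: numeral_3_eq_3)
  qed (use pp n in auto)
  then show "real (diam_worst (SL 2 (p ^ n))) \<le> real ?c * log 2 (real (Coset.order (SL 2 (p ^ n)))) powr d"
    using pp n d by (intro polynomial_le_log_order_powr[of _ _ _ 3]) auto
qed

theorem theorem1p2:
  fixes p m :: nat
  assumes "prime p"
  shows "(m \<ge> 2 \<and> p > m \<longrightarrow>
           (\<forall>d::real. d > 4 \<longrightarrow> (\<exists>C::real. \<forall>n\<ge>1.
              real (diam_worst (SL m (p ^ n))) \<le> C * log 2 (real (Coset.order (SL m (p ^ n)))) powr d)))
       \<and> (m > 2 \<and> p \<ge> m \<longrightarrow>
           (\<forall>d::real. d > 4 \<longrightarrow> (\<exists>C::real. \<forall>n\<ge>1.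
              real (diam_worst (SL m (p ^ n))) \<le> C * log 2 (real (Coset.order (SL m (p ^ n)))) powr d)))
       \<and> (m = 2 \<and> p > 2 \<longrightarrow>
           (\<forall>d::real. d > 3 \<longrightarrow> (\<exists>C::real. \<forall>n\<ge>1.
              real (diam_worst (SL m (p ^ n))) \<le> C * log 2 (real (Coset.order (SL m (p ^ n)))) powr d)))"
proof (intro conjI impI allI)
  fix d :: real
  \<comment> \<open>Both claims with \<open>d > 4\<close> reduce to the same lemma, since
    \<open>p > m \<ge> 2\<close> and \<open>p \<ge> m > 2\<close> each give \<open>p > 2\<close> and
    \<open>m \<le> p\<close>.\<close>
  show "\<exists>C::real. \<forall>n\<ge>1.
      real (diam_worst (SL m (p ^ n))) \<le> C * log 2 (real (Coset.order (SL m (p ^ n)))) powr d"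
    if "m \<ge> 2 \<and> p > m" "d > 4"
    using that by (intro diam_worst_SL_log_order[OF assms]) auto
  show "\<exists>C::real. \<forall>n\<ge>1.
      real (diam_worst (SL m (p ^ n))) \<le> C * log 2 (real (Coset.order (SL m (p ^ n)))) powr d"
    if "m > 2 \<and> p \<ge> m" "d > 4"
    using that by (intro diam_worst_SL_log_order[OF assms]) auto
  show "\<exists>C::real. \<forall>n\<ge>1.
      real (diam_worst (SL m (p ^ n))) \<le> C * log 2 (real (Coset.order (SL m (p ^ n)))) powr d"
    if "m = 2 \<and> p > 2" "d > 3"
    using that diam_worst_SL2_log_order[OF assms] by auto
qed

end
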